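(* Let $V$ be a vertex operator algebra and let $U$ be a graded subspace of $V$ such that $V=U+C_1(V)$ and $\oplus_{n\le 0}V_{(n)}\subseteq U+\mathbb{C}\mathbf{1}$. Then $V$ is linearly spanned by the elements $$u^1_{n_1}\cdots u^r_{n_r}\mathbf{1},$$ where $r\in\mathbb{N}$, $u^i\in U$ and $n_i\in\mathbb{Z}$ for $1\le i\le r$; i.e. $U$ generates $V$ as a vertex operator algebra.
   Context: All vector spaces are over $\mathbb{C}$ and $\mathbb{N}=\{0,1,2,\dots\}$. A vertex operator algebra $V=\coprod_{n\in\mathbb{Z}}V_{(n)}$ is meant in the standard sense of Frenkel–Huang–Lepowsky: $Y(v,x)=\sum_{n\in\mathbb{Z}}v_nx^{-n-1}$, vacuum $\mathbf{1}$, $Y(\omega,x)=\sum_n L(n)x^{-n-2}$, $V_{(n)}$ is the $L(0)$-eigenspace of eigenvalue $n$, $\dim V_{(n)}<\infty$, $V_{(n)}=0$ for $n$ sufficiently negative. Put $V_+=\oplus_{n>0}V_{(n)}$. $C_1(V)$ is the subspace of $V$ linearly spanned by $v_{-1}w$ for $v,w\in V_+$ together with $L(-1)V$. *)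

theory Defs
  imports Complex_Main "HOL-Library.Groups_Big_Fun" "HOL-Library.Set_Algebras"
begin

definition (in module) internal_direct_sum :: "'b set \<Rightarrow> ('i \<Rightarrow> 'b set) \<Rightarrow> bool" where
  "internal_direct_sum W S \<longleftrightarrow>
     subspace W \<and> (\<forall>i. subspace (S i) \<and> S i \<subseteq> W) \<and>
     (\<forall>w\<in>W. \<exists>!f. finite {i. f i \<noteq> 0} \<and> (\<forall>i. f i \<in> S i) \<and> w = Sum_any f)"

text \<open>
  The underlying space is the whole type. \<open>Y v n w\<close> is the mode \<open>v\<^sub>n w\<close>, that is, the coefficient
  of \<open>x\<close> to the power \<open>-n-1\<close> in \<open>Y(v,x)w\<close>.
\<close>
locale vertex_data = vector_space scale
  for scale :: "complex \<Rightarrow> 'v::ab_group_add \<Rightarrow> 'v" (infixr \<open>*s\<close> 75) +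
  fixes Y :: "'v \<Rightarrow> int \<Rightarrow> 'v \<Rightarrow> 'v"
    and vac :: 'v
    and conf :: 'v
begin

definition L :: "int \<Rightarrow> 'v \<Rightarrow> 'v" where
  "L n = Y conf (n + 1)"

definition weight_space :: "int \<Rightarrow> 'v set" where
  "weight_space n = {v. L 0 v = of_int n *s v}"

definition V_plus :: "'v set" where
  "V_plus = span (\<Union>n\<in>{0<..}. weight_space n)"

definition V_nonpos :: "'v set" where
  "V_nonpos = span (\<Union>n\<in>{..0}. weight_space n)"

definition C1 :: "'v set" where
  "C1 = span ({Y v (- 1) w | v w. v \<in> V_plus \<and> w \<in> V_plus} \<union> range (L (- 1)))"

definition graded_subspace :: "'v set \<Rightarrow> bool" where
  "graded_subspace U \<longleftrightarrow> internal_direct_sum U (\<lambda>n. U \<inter> weight_space n)"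

text \<open>The list \<open>[(u1, n1), \<dots>, (ur, nr)]\<close> is sent to \<open>Y u1 n1 (\<dots> (Y ur nr vac))\<close>.\<close>
definition word :: "('v \<times> int) list \<Rightarrow> 'v" where
  "word xs = foldr (\<lambda>(u, n). Y u n) xs vac"

text \<open>
  The conformal vector is not required to lie in a subalgebra. Hence \<open>generates U\<close> below also
  implies that \<open>U\<close> generates in the sense where subalgebras have to contain \<open>conf\<close>.
\<close>
definition vertex_subalgebra :: "'v set \<Rightarrow> bool" where
  "vertex_subalgebra W \<longleftrightarrow>
     subspace W \<and> vac \<in> W \<and> (\<forall>a\<in>W. \<forall>b\<in>W. \<forall>n. Y a n b \<in> W)"

definition generates :: "'v set \<Rightarrow> bool" where
  "generates U \<longleftrightarrow> \<Inter> {W. vertex_subalgebra W \<and> U \<subseteq> W} = UNIV"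

end

text \<open>
  The axioms of Frenkel, Huang and Lepowsky, written out in modes. \<open>Jacobi\<close> is the coefficient of
  \<open>x0\<close>, \<open>x1\<close>, \<open>x2\<close> to the powers \<open>-l-1\<close>, \<open>-m-1\<close>, \<open>-n-1\<close> in the Jacobi identity applied to \<open>w\<close>;
  all its sums have finite support by \<open>truncation\<close>. The central charge \<open>c\<close> is any complex number.
  That \<open>vac\<close> and \<open>conf\<close> are homogeneous of weights 0 and 2 follows from \<open>creation\<close> and \<open>Virasoro\<close>.
\<close>
locale vertex_operator_algebra = vertex_data scale Y vac conf
  for scale :: "complex \<Rightarrow> 'v::ab_group_add \<Rightarrow> 'v" (infixr \<open>*s\<close> 75)
    and Y :: "'v \<Rightarrow> int \<Rightarrow> 'v \<Rightarrow> 'v"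
    and vac :: 'v
    and conf :: 'v +
  fixes c :: complex
  assumes linear_left: "Vector_Spaces.linear (*s) (*s) (\<lambda>v. Y v n w)"
    and linear_right: "Vector_Spaces.linear (*s) (*s) (Y v n)"
    and grading: "internal_direct_sum UNIV weight_space"
    and weight_space_fin_dim: "\<exists>B. finite B \<and> weight_space n = span B"
    and weight_bounded_below: "\<exists>N. \<forall>n<N. weight_space n = {0}"
    and truncation: "\<exists>N. \<forall>n\<ge>N. Y v n w = 0"
    and vacuum: "Y vac n w = (if n = - 1 then w else 0)"
    and creation: "n \<ge> 0 \<Longrightarrow> Y v n vac = 0" "Y v (- 1) vac = v"
    and Jacobi:
      "Sum_any (\<lambda>i. ((- 1) ^ i * (of_int l gchoose i)) *s Y u (m + l - int i) (Y v (n + int i) w))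
       - Sum_any (\<lambda>i. ((- 1) powi l * (- 1) ^ i * (of_int l gchoose i)) *s
                  Y v (n + l - int i) (Y u (m + int i) w))
       = Sum_any (\<lambda>i. (of_int m gchoose i) *s Y (Y u (l + int i) v) (m + n - int i) w)"
    and Virasoro:
      "L m (L n v) - L n (L m v) =
       of_int (m - n) *s L (m + n) v
       + (if m + n = 0 then (of_int (m ^ 3 - m) / 12 * c) *s v else 0)"
    and derivative: "Y (L (- 1) v) n w = - (of_int n *s Y v (n - 1) w)"

end

theory Submission
  imports Defs
begin

text \<open>
  By the iterate formula (the case \<open>m = 0\<close> of the Jacobi identity) the span \<open>W\<close> of the words in
  \<open>U\<close> is closed under all modes of its elements. That \<open>W\<close> contains every weight space is shown by
  induction on the weight \<open>n\<close>. For \<open>n \<le> 0\<close> it is a hypothesis. For \<open>n > 0\<close> take the component of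
  weight \<open>n\<close> in \<open>V = U + C1(V)\<close>: the component of the first summand is in \<open>U\<close>, since \<open>U\<close> is
  graded, and that of the second is a sum of elements \<open>v\<^sub>-\<^sub>1 w\<close> and \<open>L(-1) x = x\<^sub>-\<^sub>2 1\<close> with \<open>v\<close>, \<open>w\<close>,
  \<open>x\<close> homogeneous of weight less than \<open>n\<close>.
\<close>

section \<open>Homogeneous components with respect to a direct sum\<close>

definition (in module) component :: "('i \<Rightarrow> 'b set) \<Rightarrow> 'b \<Rightarrow> 'i \<Rightarrow> 'b" where
  "component S w = (THE f. finite {i. f i \<noteq> 0} \<and> (\<forall>i. f i \<in> S i) \<and> w = Sum_any f)"

context module
begin

text \<open>On infinite support \<open>Sum_any\<close> is 0, so the sums of the iterate formula stay
  in a subspace as soon as their terms do.\<close>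

lemma subspace_Sum_any:
  assumes "subspace W" and "\<And>i. f i \<in> W"
  shows "Sum_any f \<in> W"
  using assms by (auto simp: Sum_any.expand_set intro: subspace_sum)

context
  fixes S :: "'i \<Rightarrow> 'b set"
  assumes direct: "internal_direct_sum UNIV S"
begin

lemma subspace_summand: "subspace (S i)"
  using direct by (auto simp: internal_direct_sum_def)

lemma component_props:
  "finite {i. component S w i \<noteq> 0}" "component S w i \<in> S i" "Sum_any (component S w) = w"
proof -
  have "\<exists>!f. finite {i. f i \<noteq> 0} \<and> (\<forall>i. f i \<in> S i) \<and> w = Sum_any f"
    using direct by (auto simp: internal_direct_sum_def)
  from theI'[OF this, folded component_def]
  show "finite {i. component S w i \<noteq> 0}" "component S w i \<in> S i" "Sum_any (component S w) = w"
    by auto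
qed

lemma component_eqI:
  assumes "finite {i. f i \<noteq> 0}" "\<And>i. f i \<in> S i" "w = Sum_any f"
  shows "component S w = f"
proof -
  have "\<exists>!f. finite {i. f i \<noteq> 0} \<and> (\<forall>i. f i \<in> S i) \<and> w = Sum_any f"
    using direct by (auto simp: internal_direct_sum_def)
  then show ?thesis
    unfolding component_def by (rule the1_equality) (use assms in auto)
qed

lemma component_add: "component S (v + w) i = component S v i + component S w i"
proof -
  have "component S (v + w) = (\<lambda>i. component S v i + component S w i)"
  proof (rule component_eqI)
    show "finite {i. component S v i + component S w i \<noteq> 0}"
      by (rule finite_subset[of _ "{i. component S v i \<noteq> 0} \<union> {i. component S w i \<noteq> 0}"])
        (auto simp: component_props)
    show "component S v i + component S w i \<in> S i" for i
      by (intro subspace_add subspace_summand component_props)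
    show "v + w = Sum_any (\<lambda>i. component S v i + component S w i)"
      by (simp add: Sum_any.distrib component_props)
  qed
  then show ?thesis by simp
qed

lemma component_scale: "component S (a *s w) i = a *s component S w i"
proof -
  have "component S (a *s w) = (\<lambda>i. a *s component S w i)"
  proof (rule component_eqI)
    have sub: "{i. a *s component S w i \<noteq> 0} \<subseteq> {i. component S w i \<noteq> 0}"
      by auto
    show "finite {i. a *s component S w i \<noteq> 0}"
      by (rule finite_subset[OF sub component_props(1)])
    show "a *s component S w i \<in> S i" for i
      by (intro subspace_scale subspace_summand component_props)
    have "a *s w = a *s Sum_any (component S w)"
      by (simp add: component_props)
    \<comment> \<open>For \<open>a = 0\<close> the scaled family has smaller support, so its sum is
      taken over the support of the unscaled one.\<close>
    also have "\<dots> = Sum_any (\<lambda>i. a *s component S w i)"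
      using Sum_any.expand_superset[OF component_props(1) sub]
      by (simp add: Sum_any.expand_set[of "component S w"] scale_sum_right)
    finally show "a *s w = Sum_any (\<lambda>i. a *s component S w i)" .
  qed
  then show ?thesis by simp
qed

lemma component_summand:
  assumes "w \<in> S j"
  shows "component S w i = (if i = j then w else 0)"
proof -
  have "component S w = (\<lambda>i. if i = j then w else 0)"
  proof (rule component_eqI)
    show "finite {i. (if i = j then w else 0) \<noteq> 0}"
      by (rule finite_subset[of _ "{j}"]) auto
    show "(if i = j then w else 0) \<in> S i" for i
      using assms subspace_0[OF subspace_summand] by auto
    show "w = Sum_any (\<lambda>i. if i = j then w else 0)"
      by simp
  qed
  then show ?thesis by simp
qed

text \<open>With \<open>span_minimal\<close> this reduces a claim about the components of all
  vectors in a span to the generators.\<close>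

lemma subspace_component_vimage:
  assumes "subspace W"
  shows "subspace {w. component S w i \<in> W}"
  \<comment> \<open>This instance says that the component of 0 is 0.\<close>
  using assms component_scale[of 0 0 i]
  by (auto simp: subspace_def component_add component_scale)

lemma span_summands: "span (\<Union>i. S i) = UNIV"
proof -
  have "w \<in> span (\<Union>i. S i)" for w
    using subspace_Sum_any[of "span (\<Union>i. S i)" "component S w"] component_props
    by (metis UN_I UNIV_I span_base subspace_span)
  then show ?thesis by auto
qed

text \<open>A decomposition inside \<open>U\<close> is also one in the whole space, so uniqueness
  identifies the two.\<close>

lemma component_graded_subspace:
  assumes "internal_direct_sum U (\<lambda>i. U \<inter> S i)" and "u \<in> U"
  shows "component S u i \<in> U"
proof -
  obtain f where "finite {i. f i \<noteq> 0}" "\<forall>i. f i \<in> U \<inter> S i" "u = Sum_any f"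
    using assms unfolding internal_direct_sum_def by blast
  then show ?thesis
    using component_eqI[of f u] by auto
qed

end

end

section \<open>Modes, weights and the vacuum\<close>

context vertex_operator_algebra
begin

lemma Y_linear_simps:
  "Y (u + v) n w = Y u n w + Y v n w" "Y (a *s v) n w = a *s Y v n w" "Y 0 n w = 0"
  "Y v n (w + x) = Y v n w + Y v n x" "Y v n (a *s w) = a *s Y v n w" "Y v n 0 = 0"
proof -
  interpret left: Vector_Spaces.linear "(*s)" "(*s)" "\<lambda>v. Y v n w" by (rule linear_left)
  interpret right: Vector_Spaces.linear "(*s)" "(*s)" "Y v n" by (rule linear_right)
  show "Y (u + v) n w = Y u n w + Y v n w" "Y (a *s v) n w = a *s Y v n w" "Y 0 n w = 0"
    "Y v n (w + x) = Y v n w + Y v n x" "Y v n (a *s w) = a *s Y v n w" "Y v n 0 = 0"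
    by (fact left.add left.scale left.zero right.add right.scale right.zero)+
qed

text \<open>The binomial series breaks off at a natural upper argument; \<open>k = 0\<close> and
  \<open>k = 1\<close> leave one or two terms of \<open>Jacobi\<close>.\<close>

lemma Sum_any_gchoose:
  "Sum_any (\<lambda>i. (a i * (of_nat k gchoose i)) *s f i) = (\<Sum>i\<le>k. (a i * of_nat (k choose i)) *s f i)"
proof -
  have "Sum_any (\<lambda>i. (a i * (of_nat k gchoose i)) *s f i)
      = (\<Sum>i\<le>k. (a i * (of_nat k gchoose i)) *s f i)"
  proof (rule Sum_any.expand_superset)
    have "i \<le> k" if "(of_nat k :: complex) gchoose i \<noteq> 0" for i
      using that by (simp flip: binomial_gbinomial)
    then show "{i. (a i * (of_nat k gchoose i)) *s f i \<noteq> 0} \<subseteq> {..k}"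
      by auto
  qed simp
  then show ?thesis by (simp add: binomial_gbinomial)
qed

lemmas Sum_any_gchoose_simps =
  Sum_any_gchoose[where k = 0, simplified] Sum_any_gchoose[where a = "\<lambda>_. 1" and k = 0, simplified]
  Sum_any_gchoose[where a = "\<lambda>_. 1" and k = 1, simplified]

text \<open>Modes of \<open>Y u l v\<close> are expressed through those of \<open>u\<close> and
  \<open>v\<close>, so a subspace preserved by the latter is preserved by the former.\<close>

lemma iterate_formula:
  "Y (Y u l v) n w =
     Sum_any (\<lambda>i. ((- 1) ^ i * (of_int l gchoose i)) *s Y u (l - int i) (Y v (n + int i) w))
     - Sum_any (\<lambda>i. ((- 1) powi l * (- 1) ^ i * (of_int l gchoose i)) *s
                  Y v (n + l - int i) (Y u (int i) w))"
  using Jacobi[of l u 0 v n w] by (simp add: Sum_any_gchoose_simps)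

text \<open>This is \<open>Jacobi\<close> for \<open>conf\<close> with \<open>l = 0\<close> and
  \<open>m = 1\<close>. Of the two terms on its right side, the one with \<open>L (- 1) v\<close>
  becomes a multiple of \<open>Y v n w\<close> by \<open>derivative\<close>.\<close>

lemma L0_commutator: "L 0 (Y v n w) = Y v n (L 0 w) + Y (L 0 v) n w - of_int (n + 1) *s Y v n w"
  using Jacobi[of 0 conf 1 v n w] derivative[of v "n + 1" w]
  by (simp add: Sum_any_gchoose_simps L_def) (simp add: algebra_simps)

lemma weight_space_mode:
  assumes "v \<in> weight_space p" and "w \<in> weight_space q"
  shows "Y v n w \<in> weight_space (p + q - n - 1)"
  using assms
  by (simp add: weight_space_def L0_commutator Y_linear_simps algebra_simps)

lemma vac_weight: "vac \<in> weight_space 0"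
  by (simp add: weight_space_def L_def creation)

text \<open>The derivative property for mode -1 on the vacuum, where \<open>creation\<close>
  recovers the vector. Both kinds of generators of \<open>C1\<close> are thus mode products.\<close>

lemma L_minus_1: "L (- 1) v = Y v (- 2) vac"
  using derivative[of v "- 1" vac] by (simp add: creation)

section \<open>The vertex subalgebra spanned by the words\<close>

context
  fixes U :: "'v set"
begin

definition word_span :: "'v set" where
  "word_span = span {word xs | xs. \<forall>(u, n)\<in>set xs. u \<in> U}"

lemma subspace_word_span: "subspace word_span"
  by (simp add: word_span_def)

lemma vac_in_word_span: "vac \<in> word_span"
proof -
  have "word [] \<in> word_span"
    unfolding word_span_def by (rule span_base) (auto intro!: exI[of _ "[]"])
  then show ?thesis by (simp add: word_def)
qed

lemma subspace_Y_vimage: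
  assumes "subspace W"
  shows "subspace {w. Y v n w \<in> W}" "subspace {v. Y v n w \<in> W}"
  using assms by (auto simp: subspace_def Y_linear_simps)

lemma Y_in_word_span:
  assumes "u \<in> U" and "w \<in> word_span"
  shows "Y u n w \<in> word_span"
proof -
  have "Y u n (word xs) \<in> word_span" if "\<forall>(u, n)\<in>set xs. u \<in> U" for xs
  proof -
    have "word ((u, n) # xs) \<in> word_span"
      unfolding word_span_def using that assms(1)
      by (intro span_base CollectI exI[of _ "(u, n) # xs"]) auto
    then show ?thesis by (simp add: word_def)
  qed
  then have "span {word xs | xs. \<forall>(u, n)\<in>set xs. u \<in> U} \<subseteq> {w. Y u n w \<in> word_span}"
    by (intro span_minimal subspace_Y_vimage subspace_word_span) auto
  then show ?thesis using assms by (auto simp: word_span_def)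
qed

text \<open>Serves twice: for the set \<open>T\<close> below and for the minimality of
  \<open>word_span\<close>.\<close>

lemma word_in_subalgebra:
  assumes "vertex_subalgebra W" "U \<subseteq> W" "\<forall>(u, n)\<in>set xs. u \<in> U"
  shows "word xs \<in> W"
  using assms(3) assms(1,2)
  by (induction xs) (auto simp: word_def vertex_subalgebra_def)

lemma subset_word_span: "U \<subseteq> word_span"
  using Y_in_word_span[OF _ vac_in_word_span, of _ "- 1"] by (auto simp: creation)

text \<open>The vectors all of whose modes preserve \<open>word_span\<close> form a vertex
  subalgebra \<open>T\<close> by the iterate formula. It contains \<open>U\<close>, hence every
  word, hence \<open>word_span\<close>.\<close>

lemma vertex_subalgebra_word_span: "vertex_subalgebra word_span"
proof -
  define T where "T = {a. \<forall>n. \<forall>w\<in>word_span. Y a n w \<in> word_span}"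
  have "subspace T"
    using subspace_word_span by (auto simp: T_def subspace_def Y_linear_simps)
  moreover have "vac \<in> T"
    using subspace_word_span by (auto simp: T_def vacuum subspace_0)
  moreover have "Y a l b \<in> T" if "a \<in> T" "b \<in> T" for a b l
    unfolding T_def mem_Collect_eq iterate_formula using that
    by (auto simp: T_def intro!: subspace_diff subspace_Sum_any subspace_scale subspace_word_span)
  ultimately have "vertex_subalgebra T"
    by (auto simp: vertex_subalgebra_def)
  moreover have "U \<subseteq> T"
    by (auto simp: T_def Y_in_word_span)
  ultimately have "word_span \<subseteq> T"
    unfolding word_span_def using word_in_subalgebra \<open>subspace T\<close>
    by (intro span_minimal) auto
  then show ?thesis
    using subspace_word_span vac_in_word_span by (auto simp: vertex_subalgebra_def T_def)
qed

section \<open>Induction on the weight\<close>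

lemma weight_space_subset_word_span:
  assumes graded: "graded_subspace U"
    and sum: "U + C1 = UNIV"
    and nonpos: "V_nonpos \<subseteq> U + span {vac}"
  shows "weight_space n \<subseteq> word_span"
\<comment> \<open>For \<open>n > 0\<close> every smaller weight, also a nonpositive one, has smaller
  measure; all \<open>n \<le> 0\<close> have measure 0 and are settled directly.\<close>
proof (induction "nat n" arbitrary: n rule: less_induct)
  case less
  have closed: "Y a k b \<in> word_span" if "a \<in> word_span" "b \<in> word_span" for a k b
    using vertex_subalgebra_word_span that by (auto simp: vertex_subalgebra_def)
  show ?case
  proof (cases "n \<le> 0")
    case True
    have "weight_space n \<subseteq> V_nonpos"
      using True unfolding V_nonpos_def by (blast intro: span_base)
    also note nonpos
    also have "U + span {vac} \<subseteq> word_span"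
      using subset_word_span vac_in_word_span span_minimal[OF _ subspace_word_span, of "{vac}"]
      by (auto simp: set_plus_def intro!: subspace_add[OF subspace_word_span])
    finally show ?thesis .
  next
    case False
    \<comment> \<open>As \<open>D\<close> is a subspace, \<open>U + C1 \<subseteq> D\<close> can be
      checked on \<open>U\<close> and on homogeneous generators of \<open>C1\<close>.\<close>
    define D where "D = {x. component weight_space x n \<in> word_span}"
    have D: "subspace D"
      unfolding D_def by (rule subspace_component_vimage[OF grading subspace_word_span])
    \<comment> \<open>A homogeneous vector of weight other than \<open>n\<close> has component 0
      there, so only weight \<open>n\<close> needs an argument.\<close>
    have DI: "x \<in> D" if "x \<in> weight_space p" "p = n \<Longrightarrow> x \<in> word_span" for x p
      using that subspace_0[OF subspace_word_span]
      by (auto simp: D_def component_summand[OF grading])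
    have hom: "Y v (- 1) w \<in> D"
      if "v \<in> weight_space p" "w \<in> weight_space q" "0 < p" "0 < q" for v w p q
    proof (rule DI)
      show "Y v (- 1) w \<in> weight_space (p + q)"
        using weight_space_mode[OF that(1,2), of "- 1"] by simp
      \<comment> \<open>As both weights are positive, each is below \<open>n\<close>.\<close>
      show "Y v (- 1) w \<in> word_span" if "p + q = n"
        using that \<open>0 < p\<close> \<open>0 < q\<close> \<open>v \<in> _\<close> \<open>w \<in> _\<close> less[of p] less[of q] by (intro closed) auto
    qed
    \<comment> \<open>Bilinear extension from homogeneous vectors, first in \<open>v\<close>, then
      in \<open>w\<close>.\<close>
    have left: "Y v (- 1) w \<in> D" if "v \<in> V_plus" "w \<in> weight_space q" "0 < q" for v w q
    proof -
      have "V_plus \<subseteq> {v. Y v (- 1) w \<in> D}"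
        unfolding V_plus_def using hom that
        by (intro span_minimal subspace_Y_vimage D) auto
      then show ?thesis using that by auto
    qed
    have products: "Y v (- 1) w \<in> D" if "v \<in> V_plus" "w \<in> V_plus" for v w
    proof -
      have "V_plus \<subseteq> {w. Y v (- 1) w \<in> D}"
        using left[OF \<open>v \<in> V_plus\<close>] unfolding V_plus_def
        by (intro span_minimal subspace_Y_vimage D) auto
      then show ?thesis using that by auto
    qed
    have "Y x (- 2) vac \<in> D" if "x \<in> weight_space p" for x p
    proof (rule DI)
      show "Y x (- 2) vac \<in> weight_space (p + 1)"
        using weight_space_mode[OF that vac_weight, of "- 2"] by (simp add: add.commute)
      \<comment> \<open>Here \<open>p = n - 1\<close> may be 0; the induction hypothesis covers this
        too.\<close>
      show "Y x (- 2) vac \<in> word_span" if "p + 1 = n"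
        using that False \<open>x \<in> _\<close> less[of p] by (intro closed vac_in_word_span) auto
    qed
    then have "span (\<Union>p. weight_space p) \<subseteq> {x. Y x (- 2) vac \<in> D}"
      by (intro span_minimal subspace_Y_vimage D) auto
    then have "range (L (- 1)) \<subseteq> D"
      by (auto simp: L_minus_1 span_summands[OF grading])
    then have "C1 \<subseteq> D"
      unfolding C1_def using products by (intro span_minimal D) auto
    moreover have "U \<subseteq> D"
      using component_graded_subspace[OF grading graded[unfolded graded_subspace_def]]
        subset_word_span by (auto simp: D_def)
    ultimately have "U + C1 \<subseteq> D"
      by (auto simp: set_plus_def intro!: subspace_add[OF D])
    then have "component weight_space v n \<in> word_span" for v
      using sum by (auto simp: D_def)
    \<comment> \<open>A vector of weight \<open>n\<close> is its own component.\<close>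
    then show ?thesis
      by (metis component_summand[OF grading] subsetI)
  qed
qed

lemma word_span_eq_UNIV:
  assumes "graded_subspace U" "U + C1 = UNIV" "V_nonpos \<subseteq> U + span {vac}"
  shows "word_span = UNIV"
  using span_minimal[OF _ subspace_word_span, of "\<Union>p. weight_space p"]
    weight_space_subset_word_span[OF assms]
  by (auto simp: span_summands[OF grading])

lemma generates_if_word_span_eq_UNIV:
  assumes "word_span = UNIV"
  shows "generates U"
proof -
  have "W = UNIV" if "vertex_subalgebra W" "U \<subseteq> W" for W
  proof -
    have "word_span \<subseteq> W"
      unfolding word_span_def using that word_in_subalgebra
      by (intro span_minimal) (auto simp: vertex_subalgebra_def)
    then show ?thesis using assms by auto
  qed
  then show ?thesis by (auto simp: generates_def)
qed

end

end

theorem proposition3p3: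
  fixes scale :: "complex \<Rightarrow> 'v::ab_group_add \<Rightarrow> 'v"
    and Y :: "'v \<Rightarrow> int \<Rightarrow> 'v \<Rightarrow> 'v"
    and vac conf :: 'v
    and c :: complex
    and U :: "'v set"
  assumes "vertex_operator_algebra scale Y vac conf c"
    and "vertex_data.graded_subspace scale Y conf U"
    and "U + vertex_data.C1 scale Y conf = UNIV"
    and "vertex_data.V_nonpos scale Y conf \<subseteq> U + module.span scale {vac}"
  shows "module.span scale {vertex_data.word Y vac xs | xs. \<forall>(u, n)\<in>set xs. u \<in> U} = UNIV
       \<and> vertex_data.generates scale Y vac U"
proof -
  interpret vertex_operator_algebra scale Y vac conf c by fact
  show ?thesis
    using word_span_eq_UNIV[OF assms(2-4)] generates_if_word_span_eq_UNIV[of U]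
    by (simp add: word_span_def)
qed

end
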